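(* Let $p\in(0,1)$. Suppose that $F\in \mathcal{F}^{+}_{1}$, and let $F_1,F_2,\ldots \in \mathcal{F}^{+}_{1}$ be any sequence of (possibly random) cdf's such that $\sup_{x\in \mathbb{R}} | F_n(x) - F(x)| \stackrel{\mathbb{P}}{\to} 0$ when $n\to \infty$. Then $$\int_p^1 F_n^{-1}(u)\, du -\int_p^1 F^{-1}(u)\, du =\int^{\infty }_{F^{-1}(p)} \big( F(x)- F_n(x)\big)\, dx +o_{\mathbb{P}}(1)$$ and, therefore, the consistency statement $$\int_p^1 F_n^{-1}(u)\, du \stackrel{\mathbb{P}}{\to}\int_p^1 F^{-1}(u)\, du$$ holds if and only if $$\int^{\infty }_{F^{-1}(p)} \big( 1- F_n(x)\big)\, dx \stackrel{\mathbb{P}}{\to} \int^{\infty }_{F^{-1}(p)} \big( 1- F(x)\big)\, dx .$$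
   Context: The quantile function of a cdf $F$ is $F^{-1}(u)=\inf\{x\in\mathbb{R}: F(x)\ge u\}$ for $u\in(0,1]$ and $F^{-1}(0)=\lim_{u\downarrow 0}F^{-1}(u)$. The class $\mathcal{F}^{+}_{1}$ consists of all (deterministic) cdf's $F$ for which $\int_p^1 F^{-1}(u)\,du$ is finite (for $p\in(0,1)$); equivalently, $\mathbb{E}(X^{+})<\infty$ for $X\sim F$, where $X^{+}=X\vee 0$. The cdf $F$ is deterministic. The $F_n$ may be random: on an underlying probability space $(\Omega,\mathcal{A},\mathbb{P})$, $F_n:\Omega\times\mathbb{R}\to[0,1]$ is jointly measurable and $F_n(\omega,\cdot)$ is a cdf for almost all $\omega$; $F_n\in\mathcal{F}^{+}_{1}$ means that $F_n(\omega,\cdot)\in\mathcal{F}^{+}_{1}$ for almost all $\omega$. No particular sampling design or dependence structure is assumed. $\stackrel{\mathbb{P}}{\to}$ denotes convergence in probability, and $o_{\mathbb{P}}(1)$ denotes a term converging to $0$ in probability as $n\to\infty$. *)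

theory Defs
  imports "HOL-Probability.Probability"
begin

definition is_cdf :: "(real \<Rightarrow> real) \<Rightarrow> bool" where
  "is_cdf F \<longleftrightarrow> (\<exists>\<mu>. real_distribution \<mu> \<and> F = cdf \<mu>)"

(* Extended-real valued, since F^{-1}(0) and F^{-1}(1) may be infinite; for a cdf F and 0 < u < 1
   the value is a real number.  Only arguments u in [0,1] are meaningful. *)
definition quantile :: "(real \<Rightarrow> real) \<Rightarrow> real \<Rightarrow> ereal" where
  "quantile F u =
    (if u = 0 then Lim (at_right 0) (\<lambda>v. Inf {ereal x | x. F x \<ge> v})
     else Inf {ereal x | x. F x \<ge> u})"

(* The quantile function is bounded below on (p,1), so finiteness of its integral over (p,1) is
   Lebesgue integrability.  If it holds for one p in (0,1), it holds for all of them. *)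
definition F1_plus :: "(real \<Rightarrow> real) set" where
  "F1_plus = {F. is_cdf F \<and>
    (\<forall>p::real. 0 < p \<and> p < 1 \<longrightarrow>
      interval_lebesgue_integrable lborel p 1 (\<lambda>u. real_of_ereal (quantile F u)))}"

(* The measurability and range conditions are required for every \<omega>, while F \<omega> is a cdf in F1_plus
   only for almost every \<omega>. *)
definition random_F1_plus :: "'a measure \<Rightarrow> ('a \<Rightarrow> real \<Rightarrow> real) \<Rightarrow> bool" where
  "random_F1_plus M F \<longleftrightarrow>
    (\<lambda>(\<omega>, x). F \<omega> x) \<in> borel_measurable (M \<Otimes>\<^sub>M borel) \<and>
    (\<forall>\<omega>\<in>space M. \<forall>x. F \<omega> x \<in> {0..1}) \<and>
    (AE \<omega> in M. F \<omega> \<in> F1_plus)"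

(* Convergence in probability of X n to Y.  The quantities it is applied to are pinned down only up
   to a null set (where F n \<omega> need not be a cdf), so they are measurable for the completion of M but
   perhaps not for M itself.  Outer probability is insensitive to this, and it is the probability
   whenever the event is measurable (outer_measure_of_eq); measure M would silently return 0 on
   non-measurable events. *)
definition conv_in_prob :: "'a measure \<Rightarrow> (nat \<Rightarrow> 'a \<Rightarrow> real) \<Rightarrow> ('a \<Rightarrow> real) \<Rightarrow> bool" where
  "conv_in_prob M X Y \<longleftrightarrow>
    (\<forall>\<epsilon>>0. (\<lambda>n. outer_measure_of M {\<omega> \<in> space M. \<bar>X n \<omega> - Y \<omega>\<bar> > \<epsilon>}) \<longlonglongrightarrow> 0)"

definition upper_quantile_integral :: "real \<Rightarrow> (real \<Rightarrow> real) \<Rightarrow> real" where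
  "upper_quantile_integral p F = (LBINT u=p..1. real_of_ereal (quantile F u))"

end

(* Writing F^{-1}(u) - c as the integral of 1[F x < u] over x > c minus that of 1[u <= F x] over
   x < c and swapping the integrals expresses the upper quantile integral through F alone.  With
   c = F^{-1}(p) for both F and F_n, the remainder is minus the integral of (p - F_n)^+ over x > c
   plus (F_n - p)^+ over x < c.  Fix F a < p < F b.  Once d = sup |F_n - F| is below both
   p - F a and F b - p, these integrands vanish outside [a, b] and are at most d, so the remainder
   is at most d (b - a); no convergence of F_n^{-1}(p) is needed. *)
theory Submission
  imports Defs
begin

section \<open>Convergence in probability via outer measure\<close>

text \<open>Outer measure is subadditive and blind to null sets, so a deviation of \<open>X\<close>
  that almost surely forces one of two vanishing deviations vanishes too. The threshold \<eta> must
  be uniform in \<open>n\<close>, while the null set may vary with \<open>n\<close>.\<close>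

lemma conv_in_prob_dominated:
  assumes "conv_in_prob M X1 Y1" and "conv_in_prob M X2 Y2"
    and dom: "\<And>\<epsilon>. \<epsilon> > 0 \<Longrightarrow> \<exists>\<eta>>0. \<forall>n. AE \<omega> in M. \<bar>X n \<omega> - Y \<omega>\<bar> > \<epsilon> \<longrightarrow>
      \<bar>X1 n \<omega> - Y1 \<omega>\<bar> > \<eta> \<or> \<bar>X2 n \<omega> - Y2 \<omega>\<bar> > \<eta>"
  shows "conv_in_prob M X Y"
  unfolding conv_in_prob_def
proof (intro allI impI)
  fix \<epsilon> :: real assume "\<epsilon> > 0"
  then obtain \<eta> where \<eta>: "\<eta> > 0" and ae: "\<And>n. AE \<omega> in M. \<bar>X n \<omega> - Y \<omega>\<bar> > \<epsilon> \<longrightarrow>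
      \<bar>X1 n \<omega> - Y1 \<omega>\<bar> > \<eta> \<or> \<bar>X2 n \<omega> - Y2 \<omega>\<bar> > \<eta>"
    using dom by blast
  define S where "S n = {\<omega> \<in> space M. \<bar>X n \<omega> - Y \<omega>\<bar> > \<epsilon>}" for n
  define S1 where "S1 n = {\<omega> \<in> space M. \<bar>X1 n \<omega> - Y1 \<omega>\<bar> > \<eta>}" for n
  define S2 where "S2 n = {\<omega> \<in> space M. \<bar>X2 n \<omega> - Y2 \<omega>\<bar> > \<eta>}" for n
  have le: "outer_measure_of M (S n) \<le> outer_measure_of M (S1 n) + outer_measure_of M (S2 n)" for n
  proof -
    \<comment> \<open>The deviation events may be non-measurable, so they are replaced by measurable
      covers of the same outer measure, where subadditivity of \<open>emeasure\<close>
      applies.\<close>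
    obtain E1 where E1: "E1 \<in> sets M" "S1 n \<subseteq> E1" "outer_measure_of M (S1 n) = emeasure M E1"
      using outer_measure_of_attain[of "S1 n" M] by (auto simp: S1_def)
    obtain E2 where E2: "E2 \<in> sets M" "S2 n \<subseteq> E2" "outer_measure_of M (S2 n) = emeasure M E2"
      using outer_measure_of_attain[of "S2 n" M] by (auto simp: S2_def)
    obtain N where N: "N \<in> null_sets M" and "{\<omega> \<in> space M. \<not> (\<bar>X n \<omega> - Y \<omega>\<bar> > \<epsilon> \<longrightarrow>
        \<bar>X1 n \<omega> - Y1 \<omega>\<bar> > \<eta> \<or> \<bar>X2 n \<omega> - Y2 \<omega>\<bar> > \<eta>)} \<subseteq> N"
      using ae[of n] unfolding eventually_ae_filter by blast
    then have "S n \<subseteq> E1 \<union> E2 \<union> N"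
      using E1(2) E2(2) unfolding S_def S1_def S2_def by blast
    then have "outer_measure_of M (S n) \<le> emeasure M (E1 \<union> E2 \<union> N)"
      using outer_measure_of_mono[of "S n" "E1 \<union> E2 \<union> N" M] E1(1) E2(1) N
      by (subst (asm) (2) outer_measure_of_eq) auto
    also have "\<dots> = emeasure M (E1 \<union> E2)"
      using E1(1) E2(1) N by (intro emeasure_Un_null_set) auto
    also have "\<dots> \<le> emeasure M E1 + emeasure M E2"
      using E1(1) E2(1) by (rule emeasure_subadditive)
    finally show ?thesis
      using E1(3) E2(3) by simp
  qed
  have "(\<lambda>n. outer_measure_of M (S1 n)) \<longlonglongrightarrow> 0" "(\<lambda>n. outer_measure_of M (S2 n)) \<longlonglongrightarrow> 0"
    using assms(1,2) \<eta> unfolding conv_in_prob_def S1_def S2_def by auto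
  then have lim: "(\<lambda>n. outer_measure_of M (S1 n) + outer_measure_of M (S2 n)) \<longlonglongrightarrow> 0"
    using tendsto_add[of _ 0 sequentially _ 0] by fastforce
  show "(\<lambda>n. outer_measure_of M {\<omega> \<in> space M. \<bar>X n \<omega> - Y \<omega>\<bar> > \<epsilon>}) \<longlonglongrightarrow> 0"
    unfolding S_def[symmetric]
    by (rule tendsto_sandwich[OF _ _ tendsto_const lim]) (simp_all add: le)
qed

text \<open>If both terms on the right are at most \<epsilon>/2, the left side is at most
  \<epsilon>. This form serves both directions of the final equivalence.\<close>

lemma conv_in_prob_perturb:
  assumes "conv_in_prob M R (\<lambda>_. 0)" and "conv_in_prob M X1 Y1"
    and "\<And>n. AE \<omega> in M. \<bar>X n \<omega> - Y \<omega>\<bar> \<le> \<bar>X1 n \<omega> - Y1 \<omega>\<bar> + \<bar>R n \<omega>\<bar>"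
  shows "conv_in_prob M X Y"
proof (rule conv_in_prob_dominated[OF assms(2,1)])
  fix \<epsilon> :: real assume "\<epsilon> > 0"
  show "\<exists>\<eta>>0. \<forall>n. AE \<omega> in M. \<bar>X n \<omega> - Y \<omega>\<bar> > \<epsilon> \<longrightarrow>
      \<bar>X1 n \<omega> - Y1 \<omega>\<bar> > \<eta> \<or> \<bar>R n \<omega> - 0\<bar> > \<eta>"
  proof (intro exI[of _ "\<epsilon> / 2"] conjI allI)
    fix n show "AE \<omega> in M. \<bar>X n \<omega> - Y \<omega>\<bar> > \<epsilon> \<longrightarrow>
      \<bar>X1 n \<omega> - Y1 \<omega>\<bar> > \<epsilon> / 2 \<or> \<bar>R n \<omega> - 0\<bar> > \<epsilon> / 2"
      using assms(3)[of n] by eventually_elim (auto simp: field_simps)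
  qed (use \<open>\<epsilon> > 0\<close> in simp)
qed

section \<open>Quantiles of a cdf as a Galois connection\<close>

lemma is_cdf_D:
  assumes "is_cdf G"
  shows "mono G" and "0 \<le> G x" and "G x \<le> 1" and "right_continuous_mono G 0 1"
proof -
  obtain \<mu> where "real_distribution \<mu>" and G: "G = cdf \<mu>"
    using assms unfolding is_cdf_def by blast
  then interpret cdf_distribution \<mu>
    unfolding cdf_distribution_def by simp
  show "mono G" "0 \<le> G x" "G x \<le> 1" "right_continuous_mono G 0 1"
    unfolding G by (simp_all add: mono cdf_nonneg cdf_bounded_prob right_continuous_mono_axioms)
qed

text \<open>Right continuity makes the infimum attained at a real point, so the extended-real
  infimum coincides with the real one, written \<open>I u\<close> in the locale
  \<open>right_continuous_mono\<close>.\<close>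

lemma quantile_eq_Inf:
  assumes "is_cdf G" and u: "0 < u" "u < 1"
  shows "quantile G u = ereal (Inf {x. u \<le> G x})"
proof -
  interpret right_continuous_mono G 0 1
    using assms(1) by (rule is_cdf_D(4))
  have "Inf {ereal x | x. G x \<ge> u} = ereal (I u)"
  proof (rule Inf_eqI)
    fix i assume "i \<in> {ereal x | x. G x \<ge> u}"
    then obtain x where x: "i = ereal x" "u \<le> G x"
      by blast
    show "ereal (I u) \<le> i"
      unfolding x(1) ereal_less_eq by (rule pseudoinverse[OF u, THEN iffD1, OF x(2)])
  next
    fix y assume "\<And>i. i \<in> {ereal x | x. G x \<ge> u} \<Longrightarrow> y \<le> i"
    moreover have "u \<le> G (I u)"
      by (rule pseudoinverse[OF u, THEN iffD2, OF order_refl])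
    ultimately show "y \<le> ereal (I u)"
      by blast
  qed
  then show ?thesis
    using u by (simp add: quantile_def)
qed

lemma real_quantile_le_iff:
  assumes "is_cdf G" and "0 < u" "u < 1"
  shows "real_of_ereal (quantile G u) \<le> x \<longleftrightarrow> u \<le> G x"
proof -
  interpret right_continuous_mono G 0 1
    using assms(1) by (rule is_cdf_D(4))
  show ?thesis
    unfolding quantile_eq_Inf[OF assms] real_of_ereal.simps
    by (rule pseudoinverse[OF assms(2,3), symmetric])
qed

section \<open>The upper quantile integral expressed through the cdf\<close>

text \<open>The integral over u in (p,1) of 1[x > c] 1[G x < u] - 1[x < c] 1[u <= G x]; cutting u
  off at p produces \<open>max p (G x)\<close>. The base point \<open>c\<close> is free, so that two
  cdfs can share it.\<close>

definition tail_kernel :: "real \<Rightarrow> real \<Rightarrow> (real \<Rightarrow> real) \<Rightarrow> real \<Rightarrow> real" where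
  "tail_kernel p c G x =
    indicator {c<..} x * (1 - max p (G x)) - indicator {..<c} x * (max p (G x) - p)"

lemma upper_quantile_integral_eq:
  assumes G: "G \<in> F1_plus" and p: "0 < p" "p < 1"
  shows "integrable lborel (tail_kernel p c G)"
    and "upper_quantile_integral p G = c * (1 - p) + (LINT x|lborel. tail_kernel p c G x)"
proof -
  have cdf: "is_cdf G"
    using G by (simp add: F1_plus_def)
  have [measurable]: "G \<in> borel_measurable borel"
    using is_cdf_D(1)[OF cdf] by (rule borel_measurable_mono)
  define Q where "Q u = real_of_ereal (quantile G u)" for u
  have Q: "Q u \<le> x \<longleftrightarrow> u \<le> G x" if "u \<in> {p<..<1}" for u x
    using that p real_quantile_le_iff[OF cdf, of u x] by (simp add: Q_def)
  have intQ: "integrable lborel (\<lambda>u. indicator {p<..<1} u * Q u)"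
  proof -
    have "interval_lebesgue_integrable lborel (ereal p) (ereal 1) Q"
      using G p unfolding F1_plus_def Q_def[abs_def] by (simp add: one_ereal_def)
    then show ?thesis
      using p by (simp add: interval_lebesgue_integrable_def set_integrable_def)
  qed
  have uqi: "upper_quantile_integral p G = (LINT u|lborel. indicator {p<..<1} u * Q u)"
    using p by (simp add: upper_quantile_integral_def Q_def interval_lebesgue_integral_def
        set_lebesgue_integral_def one_ereal_def)
  \<comment> \<open>The signed indicator of the region between the level \<open>c\<close> and the
    graph of \<open>Q\<close>. By the Galois connection, its slices at fixed \<open>u\<close> are
    intervals between \<open>c\<close> and \<open>Q u\<close>, and those at fixed \<open>x\<close>
    are intervals ending at \<open>G x\<close>.\<close>
  define h :: "real \<Rightarrow> real \<Rightarrow> real" where "h u x = indicator {p<..<1} u *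
    (indicator {c<..} x * of_bool (G x < u) - indicator {..<c} x * of_bool (u \<le> G x))"
    for u x
  have h_x: "h u x = indicator {p<..<1} u * (indicator {c<..<Q u} x - indicator {Q u..<c} x)" for u x
    using Q[of u x] by (auto simp: h_def indicator_def of_bool_def not_le)
  \<comment> \<open>For x < c the slice is half-open; writing it as a difference leaves only
    indicators of open intervals.\<close>
  have h_u: "h u x = indicator {c<..} x * indicator {max p (G x)<..<1} u -
      indicator {..<c} x * (indicator {p<..<1} u - indicator {max p (G x)<..<1} u)" for u x
    by (auto simp: h_def indicator_def of_bool_def not_le)
  \<comment> \<open>At most one of the two intervals is nonempty, so the absolute value turns the
    difference into a sum.\<close>
  have norm_h: "norm (h u x) = indicator {p<..<1} u * (indicator {c<..<Q u} x + indicator {Q u..<c} x)"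
    for u x
    unfolding h_x by (auto simp: indicator_def)
  have I1: "(LINT x|lborel. h u x) = indicator {p<..<1} u * Q u - c * indicator {p<..<1} u" for u
    unfolding h_x by (cases "c \<le> Q u") (auto simp: algebra_simps)
  have N1: "(LINT x|lborel. norm (h u x)) = \<bar>indicator {p<..<1} u * Q u - c * indicator {p<..<1} u\<bar>" for u
    unfolding norm_h by (cases "c \<le> Q u"; cases "u \<in> {p<..<1}") (simp_all add: algebra_simps)
  have I2: "(LINT u|lborel. h u x) = tail_kernel p c G x" for x
    unfolding h_u tail_kernel_def using is_cdf_D(3)[OF cdf, of x] p by simp
  have int_ind: "integrable lborel (\<lambda>u::real. c * indicator {p<..<1} u :: real)"
    using p by (intro integrable_mult_right integrable_real_indicator) simp_all
  have int_h: "integrable (lborel \<Otimes>\<^sub>M lborel) (case_prod h)"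
  proof (rule lborel_pair.Fubini_integrable)
    show "case_prod h \<in> borel_measurable (lborel \<Otimes>\<^sub>M lborel)"
      unfolding h_def by measurable
    \<comment> \<open>The inner integral is |Q u - c| on (p,1); this is where membership in
      \<open>F1_plus\<close> enters.\<close>
    show "integrable lborel (\<lambda>u. LINT x|lborel. norm (case (u, x) of (u, x) \<Rightarrow> h u x))"
      using intQ int_ind by (simp add: N1 del: real_norm_def)
    show "AE u in lborel. integrable lborel (\<lambda>x. case (u, x) of (u, x) \<Rightarrow> h u x)"
    proof (rule AE_I2)
      fix u :: real
      show "integrable lborel (\<lambda>x. case (u, x) of (u, x) \<Rightarrow> h u x)"
        unfolding h_x prod.case by (cases "c \<le> Q u") simp_all
    qed
  qed
  show "integrable lborel (tail_kernel p c G)"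
    using lborel_pair.integrable_snd[OF int_h] by (simp add: I2)
  have "(LINT x|lborel. tail_kernel p c G x) = upper_quantile_integral p G - c * (1 - p)"
    using lborel_pair.Fubini_integral[OF int_h] intQ int_ind p by (simp add: I1 I2 uqi)
  then show "upper_quantile_integral p G = c * (1 - p) + (LINT x|lborel. tail_kernel p c G x)"
    by simp
qed

text \<open>Where G x >= 1/2, the kernel at level 1/2 equals 1 - G x on x > c. The remaining points
  x > c lie below the median \<open>b\<close>, in a bounded interval where 1 - G x is at most 1. The
  level 1/2 is an arbitrary choice in (0,1).\<close>

lemma integrable_upper_tail:
  assumes G: "G \<in> F1_plus"
  shows "set_integrable lborel {c<..} (\<lambda>x. 1 - G x)"
proof -
  have cdf: "is_cdf G"
    using G by (simp add: F1_plus_def)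
  note [measurable] = borel_measurable_mono[OF is_cdf_D(1)[OF cdf]]
  define b where "b = real_of_ereal (quantile G (1/2))"
  have b: "1/2 \<le> G x" if "b \<le> x" for x
    using real_quantile_le_iff[OF cdf, of "1/2" x] that by (simp add: b_def)
  have "integrable lborel (\<lambda>x. \<bar>tail_kernel (1/2) c G x\<bar> + indicator {c..b} x)"
    using upper_quantile_integral_eq(1)[OF G, of "1/2" c]
    by (intro Bochner_Integration.integrable_add integrable_abs integrable_real_indicator)
      (simp_all add: emeasure_lborel_Icc_eq)
  then have "integrable lborel (\<lambda>x. indicator {c<..} x * (1 - G x))"
  proof (rule Bochner_Integration.integrable_bound)
    have "norm (indicator {c<..} x * (1 - G x))
        \<le> norm (\<bar>tail_kernel (1/2) c G x\<bar> + indicator {c..b} x)" for x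
      using b[of x] is_cdf_D(2,3)[OF cdf, of x]
      by (auto simp: tail_kernel_def indicator_def max_def not_le)
    then show "AE x in lborel. norm (indicator {c<..} x * (1 - G x))
        \<le> norm (\<bar>tail_kernel (1/2) c G x\<bar> + indicator {c..b} x)"
      by (rule AE_I2)
  qed measurable
  then show ?thesis
    by (simp add: set_integrable_def)
qed

section \<open>A deterministic bound on the remainder\<close>

lemma remainder_bound:
  assumes F: "F \<in> F1_plus" and G: "G \<in> F1_plus" and p: "0 < p" "p < 1"
    and a: "F a + \<delta> \<le> p" and b: "p + \<delta> \<le> F b" and ab: "a \<le> b" and d: "d \<le> \<delta>"
    and close: "\<And>x. \<bar>G x - F x\<bar> \<le> d"
  shows "\<bar>upper_quantile_integral p G - upper_quantile_integral p F
      - (LBINT x=quantile F p..\<infinity>. F x - G x)\<bar> \<le> d * (b - a)"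
proof -
  have cdf: "is_cdf F" "is_cdf G"
    using F G by (simp_all add: F1_plus_def)
  define q where "q = Inf {x. p \<le> F x}"
  have qF: "quantile F p = ereal q"
    using quantile_eq_Inf[OF cdf(1) p] by (simp add: q_def)
  have q: "q \<le> x \<longleftrightarrow> p \<le> F x" for x
    using real_quantile_le_iff[OF cdf(1) p] qF by simp
  let ?T = "\<lambda>x. indicator {q<..} x * (F x - G x)"
  let ?r = "\<lambda>x. tail_kernel p q G x - tail_kernel p q F x - ?T x"
  have int: "integrable lborel ?T"
  proof -
    have "set_integrable lborel {q<..} (\<lambda>x. (1 - G x) - (1 - F x))"
      using F G by (intro set_integral_diff integrable_upper_tail)
    then show ?thesis
      by (simp add: set_integrable_def)
  qed
  have K: "integrable lborel (tail_kernel p q G)" "integrable lborel (tail_kernel p q F)"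
    using F G p by (intro upper_quantile_integral_eq(1); simp)+
  have T: "(LBINT x=quantile F p..\<infinity>. F x - G x) = (LINT x|lborel. ?T x)"
    by (simp add: qF interval_lebesgue_integral_def set_lebesgue_integral_def)
  \<comment> \<open>For x > q, F x >= p and \<open>?r x\<close> is -(p - G x)^+; for x < q, F x < p
    and it is -(G x - p)^+. Both are at most d in size, as p lies between F x and G x whenever they
    are nonzero. Left of \<open>a\<close>, G x <= F a + d <= p, and right of \<open>b\<close>, G x
    >= F b - d >= p, so \<open>?r\<close> vanishes there.\<close>
  have r: "\<bar>?r x\<bar> \<le> d * indicator {a..b} x" for x
  proof -
    have "F x \<le> F a" if "x < a"
      using monoD[OF is_cdf_D(1)[OF cdf(1)]] that by simp
    moreover have "F b \<le> F x" if "b < x"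
      using monoD[OF is_cdf_D(1)[OF cdf(1)]] that by simp
    ultimately show ?thesis
      using close[of x] a b d q[of x]
      by (auto simp: tail_kernel_def indicator_def max_def not_le)
  qed
  have eq: "upper_quantile_integral p G - upper_quantile_integral p F
      - (LBINT x=quantile F p..\<infinity>. F x - G x) = (LINT x|lborel. ?r x)"
    unfolding T upper_quantile_integral_eq(2)[OF F p, of q] upper_quantile_integral_eq(2)[OF G p, of q]
    using int K by simp
  have "\<bar>LINT x|lborel. ?r x\<bar> \<le> (LINT x|lborel. \<bar>?r x\<bar>)"
    by (rule integral_abs_bound)
  also have "\<dots> \<le> (LINT x|lborel. d * indicator {a..b} x)"
  proof (rule integral_mono)
    show "integrable lborel (\<lambda>x. \<bar>?r x\<bar>)"
      using int K by (intro integrable_abs Bochner_Integration.integrable_diff)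
    show "integrable lborel (\<lambda>x. d * indicator {a..b} x)"
      using ab by (intro integrable_mult_right integrable_real_indicator) simp_all
  qed (rule r)
  also have "\<dots> = d * (b - a)"
    using ab by simp
  finally show ?thesis
    unfolding eq .
qed

section \<open>Passage to random cdfs and the consistency criterion\<close>

theorem corollary3p1:
  fixes M :: "'a measure"
    and F :: "real \<Rightarrow> real"
    and Fn :: "nat \<Rightarrow> 'a \<Rightarrow> real \<Rightarrow> real"
    and p :: real
  assumes "prob_space M"
    and "0 < p" and "p < 1"
    and "F \<in> F1_plus"
    and "\<And>n. random_F1_plus M (Fn n)"
    and "conv_in_prob M (\<lambda>n \<omega>. SUP x. \<bar>Fn n \<omega> x - F x\<bar>) (\<lambda>_. 0)"
  shows "(\<exists>R. conv_in_prob M R (\<lambda>_. 0) \<and>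
            (\<forall>n. AE \<omega> in M. upper_quantile_integral p (Fn n \<omega>) - upper_quantile_integral p F
                = (LBINT x=quantile F p..\<infinity>. F x - Fn n \<omega> x) + R n \<omega>))
    \<and> (conv_in_prob M (\<lambda>n \<omega>. upper_quantile_integral p (Fn n \<omega>))
                      (\<lambda>_. upper_quantile_integral p F)
      \<longleftrightarrow> conv_in_prob M (\<lambda>n \<omega>. LBINT x=quantile F p..\<infinity>. 1 - Fn n \<omega> x)
                      (\<lambda>_. LBINT x=quantile F p..\<infinity>. 1 - F x))"
proof -
  have cdf: "is_cdf F"
    using assms(4) by (simp add: F1_plus_def)
  have F_le: "F x \<le> F y" if "x \<le> y" for x y
    using monoD[OF is_cdf_D(1)[OF cdf] that] .
  interpret right_continuous_mono F 0 1
    using cdf by (rule is_cdf_D(4))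
  \<comment> \<open>The limits 0 and 1 of \<open>F\<close> at the two infinities supply points
    strictly below and above level \<open>p\<close>.\<close>
  obtain a where a: "F a < p"
    using order_tendstoD(2)[OF bot assms(2)] by (auto dest!: eventually_happens)
  obtain b where b: "p < F b"
    using order_tendstoD(1)[OF top assms(3)] by (auto dest!: eventually_happens)
  have "a < b"
    using a b F_le[of b a] by (cases "a < b") auto
  define \<delta> where "\<delta> = min (p - F a) (F b - p)"
  have \<delta>: "\<delta> > 0" "F a + \<delta> \<le> p" "p + \<delta> \<le> F b"
    using a b by (auto simp: \<delta>_def)
  define d where "d n \<omega> = (SUP x. \<bar>Fn n \<omega> x - F x\<bar>)" for n \<omega>
  \<comment> \<open>With \<open>R\<close> defined as the exact difference, the expansion is an
    identity and all the content lies in \<open>R\<close> tending to 0.\<close>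
  define R where "R n \<omega> = upper_quantile_integral p (Fn n \<omega>) - upper_quantile_integral p F
      - (LBINT x=quantile F p..\<infinity>. F x - Fn n \<omega> x)" for n \<omega>
  have Fn: "AE \<omega> in M. Fn n \<omega> \<in> F1_plus" for n
    using assms(5)[of n] by (simp add: random_F1_plus_def)
  \<comment> \<open>A real supremum dominates its terms only if the family is bounded above; two
    cdfs differ by at most 1.\<close>
  have close: "\<bar>G x - F x\<bar> \<le> (SUP x. \<bar>G x - F x\<bar>)" if "G \<in> F1_plus" for G x
  proof (rule cSUP_upper)
    have "is_cdf G"
      using that by (simp add: F1_plus_def)
    then show "bdd_above (range (\<lambda>x. \<bar>G x - F x\<bar>))"
      using is_cdf_D(2,3)[OF \<open>is_cdf G\<close>] is_cdf_D(2,3)[OF cdf]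
      by (intro bdd_aboveI2[of _ _ 1]) (smt (verit))
  qed simp
  have bound: "\<bar>R n \<omega>\<bar> \<le> d n \<omega> * (b - a)" if "Fn n \<omega> \<in> F1_plus" "d n \<omega> \<le> \<delta>" for n \<omega>
    unfolding R_def using assms(2-4) that \<delta> \<open>a < b\<close> close[OF that(1)]
    by (intro remainder_bound[where \<delta>=\<delta>]) (auto simp: d_def)
  have R: "conv_in_prob M R (\<lambda>_. 0)"
  \<comment> \<open>A single dominating sequence suffices here, so it fills both slots.\<close>
  proof (rule conv_in_prob_dominated[OF assms(6,6)])
    fix \<epsilon> :: real assume "\<epsilon> > 0"
    \<comment> \<open>The first entry makes \<open>bound\<close> applicable; the second turns d (b -
      a) into at most \<epsilon>.\<close>
    define \<eta> where "\<eta> = min \<delta> (\<epsilon> / (b - a))"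
    have "\<eta> > 0"
      using \<delta>(1) \<open>\<epsilon> > 0\<close> \<open>a < b\<close> by (simp add: \<eta>_def)
    moreover have "AE \<omega> in M. \<bar>R n \<omega> - 0\<bar> > \<epsilon> \<longrightarrow> \<bar>d n \<omega> - 0\<bar> > \<eta> \<or> \<bar>d n \<omega> - 0\<bar> > \<eta>" for n
      using Fn[of n]
    proof eventually_elim
      case (elim \<omega>)
      have "\<bar>R n \<omega>\<bar> \<le> \<epsilon>" if "d n \<omega> \<le> \<eta>"
      proof -
        have "\<bar>R n \<omega>\<bar> \<le> d n \<omega> * (b - a)"
          using elim that by (intro bound) (simp_all add: \<eta>_def)
        also have "\<dots> \<le> \<epsilon>"
          using that \<open>a < b\<close> by (simp add: \<eta>_def pos_le_divide_eq)
        finally show ?thesis .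
      qed
      then show ?case
        by force
    qed
    ultimately show "\<exists>\<eta>>0. \<forall>n. AE \<omega> in M. \<bar>R n \<omega> - 0\<bar> > \<epsilon> \<longrightarrow>
        \<bar>(SUP x. \<bar>Fn n \<omega> x - F x\<bar>) - 0\<bar> > \<eta> \<or> \<bar>(SUP x. \<bar>Fn n \<omega> x - F x\<bar>) - 0\<bar> > \<eta>"
      unfolding d_def by blast
  qed
  define J where "J G = (LBINT x=quantile F p..\<infinity>. 1 - G x)" for G :: "real \<Rightarrow> real"
  \<comment> \<open>Splitting (1 - G) - (1 - F) requires each tail to be integrable by itself, which
    \<open>integrable_upper_tail\<close> provides.\<close>
  have J: "(LBINT x=quantile F p..\<infinity>. F x - G x) = J G - J F" if "G \<in> F1_plus" for G
  proof -
    have "set_integrable lborel {c<..} (\<lambda>x. 1 - G x)" "set_integrable lborel {c<..} (\<lambda>x. 1 - F x)" for c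
      using that assms(4) by (simp_all add: integrable_upper_tail)
    then have "(LINT x:{c<..}|lborel. (1 - G x) - (1 - F x)) =
        (LINT x:{c<..}|lborel. 1 - G x) - (LINT x:{c<..}|lborel. 1 - F x)" for c
      by (intro set_integral_diff(2))
    then show ?thesis
      using assms(2,3) quantile_eq_Inf[OF cdf] by (simp add: J_def interval_lebesgue_integral_def)
  qed
  have eq: "AE \<omega> in M. upper_quantile_integral p (Fn n \<omega>) - upper_quantile_integral p F
      = J (Fn n \<omega>) - J F + R n \<omega>" for n
    using Fn[of n] by eventually_elim (simp add: R_def J)
  \<comment> \<open>By \<open>eq\<close> the two centred quantities differ almost surely by
    \<open>R\<close>, so each is a vanishing perturbation of the other.\<close>
  have "conv_in_prob M (\<lambda>n \<omega>. upper_quantile_integral p (Fn n \<omega>)) (\<lambda>_. upper_quantile_integral p F)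
      \<longleftrightarrow> conv_in_prob M (\<lambda>n \<omega>. J (Fn n \<omega>)) (\<lambda>_. J F)"
  proof
    assume "conv_in_prob M (\<lambda>n \<omega>. upper_quantile_integral p (Fn n \<omega>))
      (\<lambda>_. upper_quantile_integral p F)"
    then show "conv_in_prob M (\<lambda>n \<omega>. J (Fn n \<omega>)) (\<lambda>_. J F)"
    proof (rule conv_in_prob_perturb[OF R])
      show "AE \<omega> in M. \<bar>J (Fn n \<omega>) - J F\<bar> \<le>
          \<bar>upper_quantile_integral p (Fn n \<omega>) - upper_quantile_integral p F\<bar> + \<bar>R n \<omega>\<bar>" for n
        using eq[of n] by eventually_elim linarith
    qed
  next
    assume "conv_in_prob M (\<lambda>n \<omega>. J (Fn n \<omega>)) (\<lambda>_. J F)"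
    then show "conv_in_prob M (\<lambda>n \<omega>. upper_quantile_integral p (Fn n \<omega>))
      (\<lambda>_. upper_quantile_integral p F)"
    proof (rule conv_in_prob_perturb[OF R])
      show "AE \<omega> in M. \<bar>upper_quantile_integral p (Fn n \<omega>) - upper_quantile_integral p F\<bar>
          \<le> \<bar>J (Fn n \<omega>) - J F\<bar> + \<bar>R n \<omega>\<bar>" for n
        using eq[of n] by eventually_elim linarith
    qed
  qed
  moreover have "\<forall>n. AE \<omega> in M. upper_quantile_integral p (Fn n \<omega>) - upper_quantile_integral p F
      = (LBINT x=quantile F p..\<infinity>. F x - Fn n \<omega> x) + R n \<omega>"
    by (simp add: R_def)
  ultimately show ?thesis
    using R unfolding J_def by blast
qed

end
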